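(* The two-dimensional sequences $\{|\Gamma_n^p|\}_{n\geq 0,\,p\geq 0}$ and $\{|\Delta_n^p|\}_{n\geq 0,\,p\geq 0}$, taken modulo $3$, are both $3$-automatic.
   Context: The Cantor sequence $\mathbf{c}=(c_n)_{n\ge 0}\in\{0,1\}^{\mathbb{N}}$ is defined by $c_0=1$, $c_{3n}=c_n$, $c_{3n+1}=0$, $c_{3n+2}=c_n$ for $n\ge 0$. The sequence $\mathbf{d}=(d_n)_{n\geq 0}$ is defined by $d_n=c_n+c_{n+2}$. For $n\ge 1$, $p\ge 0$, let $\Gamma_n^p=(c_{p+i+j-2})_{1\le i,j\le n}$ and $\Delta_n^p=(d_{p+i+j-2})_{1\le i,j\le n}$, and let $|\Gamma_n^p|$, $|\Delta_n^p|$ be their determinants. For $n=0$ the following conventions are used: $|\Gamma_0^0|=2$, $|\Gamma_0^p|=1$ for $p\ge 1$, and $|\Delta_0^p|=1$ for $p\ge 0$. A two-dimensional sequence over a finite alphabet is $3$-automatic if it is the image under a coding (letter-to-letter map) of a fixed point of a $[3,3]$-uniform matrix-valued morphism, i.e. a map sending each letter of a finite alphabet to a $3\times 3$ matrix of letters of that alphabet, extended blockwise to arrays. Equivalently (a known theorem), $\mathbf{u}=(u_{m,n})_{m,n\ge 0}$ is $3$-automatic if and only if its $3$-kernel $\{(u_{3^a m+r,\,3^a n+s})_{m,n\ge 0} : a\ge 0,\ 0\le r<3^a,\ 0\le s<3^a\}$ is a finite set of two-dimensional sequences. *)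

theory Defs
  imports "Jordan_Normal_Form.Determinant"
begin

fun cantor :: "nat \<Rightarrow> int" where
  "cantor n = (if n = 0 then 1 else if n mod 3 = 1 then 0 else cantor (n div 3))"

declare cantor.simps [simp del]

lemma cantor_rec:
  "cantor 0 = 1"
  "cantor (3 * n) = cantor n"
  "cantor (3 * n + 1) = 0"
  "cantor (3 * n + 2) = cantor n"
proof -
  have "(3 * n + 2) mod 3 = 2" "(3 * n + 2) div 3 = n" "(3 * n + 1) mod 3 = 1"
    by presburger+
  then show "cantor (3 * n + 1) = 0" "cantor (3 * n + 2) = cantor n"
    by (simp_all only: cantor.simps[of "3 * n + 1"] cantor.simps[of "3 * n + 2"]) simp_all
qed (simp_all add: cantor.simps[of 0] cantor.simps[of "3 * n"])

definition cantor_d :: "nat \<Rightarrow> int" where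
  "cantor_d n = cantor n + cantor (n + 2)"

text \<open>Matrix indices start at 0, so the entry at row \<open>i\<close>, column \<open>j\<close> is \<open>a (p + i + j)\<close>
  rather than \<open>a (p + i + j - 2)\<close>.\<close>

definition hankel_mat :: "(nat \<Rightarrow> int) \<Rightarrow> nat \<Rightarrow> nat \<Rightarrow> int mat" where
  "hankel_mat a n p = mat n n (\<lambda>(i, j). a (p + i + j))"

text \<open>The value at \<open>n = p = 0\<close> is a convention; the remaining values 1 at \<open>n = 0\<close> agree with
  the determinant of the empty matrix.\<close>

definition Gamma_det :: "nat \<Rightarrow> nat \<Rightarrow> int" where
  "Gamma_det n p =
     (if n = 0 then if p = 0 then 2 else 1 else det (hankel_mat cantor n p))"

definition Delta_det :: "nat \<Rightarrow> nat \<Rightarrow> int" where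
  "Delta_det n p = (if n = 0 then 1 else det (hankel_mat cantor_d n p))"

definition uniform_mat_morphism :: "nat \<Rightarrow> 'b set \<Rightarrow> ('b \<Rightarrow> 'b mat) \<Rightarrow> bool" where
  "uniform_mat_morphism k A \<phi> \<longleftrightarrow>
     (\<forall>a\<in>A. \<phi> a \<in> carrier_mat k k \<and> elements_mat (\<phi> a) \<subseteq> A)"

definition apply_morphism ::
  "nat \<Rightarrow> ('b \<Rightarrow> 'b mat) \<Rightarrow> (nat \<Rightarrow> nat \<Rightarrow> 'b) \<Rightarrow> nat \<Rightarrow> nat \<Rightarrow> 'b" where
  "apply_morphism k \<phi> v m n = \<phi> (v (m div k) (n div k)) $$ (m mod k, n mod k)"

text \<open>Any finite alphabet can be renamed to a finite set of natural numbers, so quantifying over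
  finite \<open>A :: nat set\<close> loses no generality. The notion is intended for \<open>k \<ge> 2\<close>.\<close>

definition automatic2 :: "nat \<Rightarrow> (nat \<Rightarrow> nat \<Rightarrow> 'a) \<Rightarrow> bool" where
  "automatic2 k u \<longleftrightarrow>
     (\<exists>(A :: nat set) \<phi> v (\<tau> :: nat \<Rightarrow> 'a).
        finite A \<and> uniform_mat_morphism k A \<phi> \<and>
        (\<forall>m n. v m n \<in> A) \<and> apply_morphism k \<phi> v = v \<and>
        u = (\<lambda>m n. \<tau> (v m n)))"

end

theory Submission
  imports Defs
begin

text \<open>The Hankel matrix of \<open>a\<close> with shift \<open>P\<close> is the Gram matrix of \<open>1, x, x\<^sup>2, \<dots>\<close> for the bilinear
  form \<open>L (x ^ P * f * g)\<close>, where \<open>L (x ^ k) = a k\<close>. Both Cantor sequences vanish at odd indices, so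
  splitting \<open>x ^ k\<close> by the parity of \<open>k\<close> reduces everything to \<open>b k = c (2 k)\<close> and
  \<open>e k = d (2 k) = b k + b (k + 1)\<close>. Modulo 3 the generating function of \<open>b\<close> is \<open>(1 + z) powr (- 1/2)\<close>,
  and multiplication by \<open>1 + x\<close> turns the form of \<open>b\<close> into that of \<open>e\<close>; since
  \<open>(1 + x) ^ 3 = 1 + x ^ 3\<close>, the forms of \<open>b\<close> and \<open>e\<close>, over polynomials in \<open>x ^ 3\<close>, become
  diagonal in a basis of three small polynomials, with diagonal entries again \<open>\<plusminus>b\<close> or \<open>\<plusminus>e\<close> up to
  a shift. If the degrees of this basis are not 0, 1, 2, one basis vector of top degree is replaced by
  a combination of two orthogonal ones, which replaces a product of two determinants by a sum of two
  such products. Hence the determinants of size \<open>3 n + r\<close> and shift \<open>3 p + s\<close> modulo 3 depend only on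
  the parity of \<open>n\<close> and on the determinants of \<open>b\<close> and \<open>e\<close> of sizes \<open>n, n + 1\<close> and shifts
  \<open>p, p + 1\<close>, so a window of such determinants is the state of a finite automaton.\<close>

section \<open>The field with three elements\<close>

text \<open>As a type, residues modulo 3 turn congruences into equations over an integral domain,
  with \<open>of_int\<close> as the reduction map.\<close>

datatype F3 = F0 | F1 | F2

instantiation F3 :: idom
begin

definition "0 = F0"
definition "1 = F1"

fun plus_F3 :: "F3 \<Rightarrow> F3 \<Rightarrow> F3" where
  "F0 + y = y"
| "x + F0 = x"
| "F1 + F1 = F2"
| "F1 + F2 = F0"
| "F2 + F1 = F0"
| "F2 + F2 = F1"

fun uminus_F3 :: "F3 \<Rightarrow> F3" where
  "- F0 = F0"
| "- F1 = F2"
| "- F2 = F1"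

fun times_F3 :: "F3 \<Rightarrow> F3 \<Rightarrow> F3" where
  "F0 * y = F0"
| "x * F0 = F0"
| "F1 * y = y"
| "x * F1 = x"
| "F2 * F2 = F1"

definition "x - y = x + - (y :: F3)"

instance
proof
  fix x y z :: F3
  show "x + y + z = x + (y + z)" "x * y * z = x * (y * z)" "(x + y) * z = x * z + y * z"
    "x * (y + z) = x * y + x * z"
    by (cases x; cases y; cases z; simp)+
  show "x + y = y + x" "x * y = y * x" "x - y = x + - y"
    by (cases x; cases y; simp add: minus_F3_def)+
  show "0 + x = x" "- x + x = 0" "1 * x = x" "0 * x = 0" "x * 0 = 0"
    by (cases x; simp add: zero_F3_def one_F3_def)+
  show "(0 :: F3) \<noteq> 1"
    by (simp add: zero_F3_def one_F3_def)
  show "x * y \<noteq> 0" if "x \<noteq> 0" "y \<noteq> 0"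
    using that by (cases x; cases y; simp add: zero_F3_def)
qed

end

lemma two_F3 [simp]: "(2 :: F3) = - 1"
  using one_add_one [where ?'a = F3] by (simp add: one_F3_def)

lemma three_F3 [simp]: "(3 :: F3) = 0"
proof -
  have "(3 :: F3) = 2 + 1" by (simp only: numeral_plus_one) simp
  then show ?thesis by simp
qed

lemma finite_UNIV_F3: "finite (UNIV :: F3 set)"
proof -
  have "UNIV = {F0, F1, F2}" using F3.exhaust by auto
  then show ?thesis by (metis finite.emptyI finite_insert)
qed

lemma of_int_F3_eq_imp_mod_eq:
  assumes "(of_int x :: F3) = of_int y"
  shows "x mod 3 = y mod 3"
proof -
  have red: "(of_int z :: F3) = of_int (z mod 3)" for z
  proof -
    have "(of_int z :: F3) = of_int (3 * (z div 3) + z mod 3)" by simp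
    also have "\<dots> = of_int (z mod 3)" by (simp only: of_int_add of_int_mult) simp
    finally show ?thesis .
  qed
  have "z mod 3 = 0 \<or> z mod 3 = 1 \<or> z mod 3 = 2" for z :: int by presburger
  from this [of x] this [of y] assms red [of x] red [of y] show ?thesis
    by (auto simp: one_F3_def zero_F3_def)
qed

section \<open>Gram determinants\<close>

definition gram :: "('v \<Rightarrow> 'v \<Rightarrow> 'a :: comm_ring_1) \<Rightarrow> 'v list \<Rightarrow> 'v list \<Rightarrow> 'a" where
  "gram \<phi> fs gs = det (mat (length fs) (length fs) (\<lambda>(i, j). \<phi> (fs ! i) (gs ! j)))"

lemma gram_commute:
  assumes "length fs = length gs" "\<And>f g. \<phi> f g = \<phi> g f"
  shows "gram \<phi> fs gs = gram \<phi> gs fs"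
proof -
  have "mat (length fs) (length fs) (\<lambda>(i, j). \<phi> (fs ! i) (gs ! j))
      = transpose_mat (mat (length gs) (length gs) (\<lambda>(i, j). \<phi> (gs ! i) (fs ! j)))"
    using assms by (intro eq_matI) auto
  then show ?thesis
    unfolding gram_def by (simp add: det_transpose[of _ "length gs"])
qed

text \<open>Rows and columns are permuted alike, so the sign enters twice and cancels. The pairs tie
  each row label to its column label.\<close>

lemma gram_permute:
  assumes "mset ps = mset qs"
  shows "gram \<phi> (map fst ps) (map snd ps) = gram \<phi> (map fst qs) (map snd qs)"
proof -
  let ?n = "length qs"
  obtain p where p: "p permutes {..<?n}" "permute_list p qs = ps"
    using mset_eq_permutation[OF assms] by blast
  have p': "p permutes {0..<?n}" using p(1) by (simp add: atLeast0LessThan)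
  have len: "length ps = ?n" using assms by (metis size_mset)
  have nth: "ps ! i = qs ! p i" if "i < ?n" for i
    using permute_list_nth[OF p(1) that] p(2) by simp
  have p_less: "p i < ?n" if "i < ?n" for i
    using permutes_in_image[OF p(1), of i] that by simp
  define A where "A = mat ?n ?n (\<lambda>(i, j). \<phi> (fst (qs ! i)) (snd (qs ! j)))"
  define B where "B = mat ?n ?n (\<lambda>(i, j). A $$ (p i, j))"
  have A: "A \<in> carrier_mat ?n ?n" and B: "B \<in> carrier_mat ?n ?n"
    by (simp_all add: A_def B_def)
  \<comment> \<open>\<open>B\<close> permutes only the rows; permuting the rows of its transpose and
    transposing back handles the columns.\<close>
  have "mat ?n ?n (\<lambda>(i, j). \<phi> (map fst ps ! i) (map snd ps ! j))
      = transpose_mat (mat ?n ?n (\<lambda>(i, j). transpose_mat B $$ (p i, j)))"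
    by (rule eq_matI) (simp_all add: A_def B_def nth p_less len)
  then have "gram \<phi> (map fst ps) (map snd ps)
      = det (mat ?n ?n (\<lambda>(i, j). transpose_mat B $$ (p i, j)))"
    unfolding gram_def by (simp add: len det_transpose[of _ ?n])
  also have "\<dots> = signof p * (signof p * det A)"
    using B p' A by (simp add: det_permute_rows det_transpose[of _ ?n] B_def)
  also have "\<dots> = det A"
    by (simp add: sign_def)
  also have "\<dots> = gram \<phi> (map fst qs) (map snd qs)"
    unfolding gram_def A_def by (intro arg_cong[of _ _ det] eq_matI) auto
  finally show ?thesis .
qed

lemma gram_mset_cong:
  assumes "mset fs = mset gs"
  shows "gram \<phi> fs fs = gram \<phi> gs gs"
  using gram_permute[of "map (\<lambda>x. (x, x)) fs" "map (\<lambda>x. (x, x)) gs" \<phi>] assms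
  by (simp add: o_def)

lemma gram_swap_blocks:
  assumes "length fs1 = length gs1" "length fs2 = length gs2" "length fs3 = length gs3"
  shows "gram \<phi> (fs1 @ fs2 @ fs3) (gs1 @ gs2 @ gs3) = gram \<phi> (fs2 @ fs1 @ fs3) (gs2 @ gs1 @ gs3)"
  using gram_permute[of "zip fs1 gs1 @ zip fs2 gs2 @ zip fs3 gs3"
      "zip fs2 gs2 @ zip fs1 gs1 @ zip fs3 gs3" \<phi>] assms
  by simp

text \<open>Only the lower left block has to vanish, so row and column vectors may differ;
  \<open>gram_pairing_glue\<close> relies on this.\<close>

lemma gram_append:
  fixes \<phi> :: "'v \<Rightarrow> 'v \<Rightarrow> 'a :: idom"
  assumes len: "length fs1 = length gs1" "length fs2 = length gs2"
    and orth: "\<And>f g. f \<in> set fs2 \<Longrightarrow> g \<in> set gs1 \<Longrightarrow> \<phi> f g = 0"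
  shows "gram \<phi> (fs1 @ fs2) (gs1 @ gs2) = gram \<phi> fs1 gs1 * gram \<phi> fs2 gs2"
proof -
  let ?n = "length fs1" and ?m = "length fs2"
  let ?B = "mat ?n ?m (\<lambda>(i, j). \<phi> (fs1 ! i) (gs2 ! j))"
  let ?A = "mat ?n ?n (\<lambda>(i, j). \<phi> (fs1 ! i) (gs1 ! j))"
  let ?D = "mat ?m ?m (\<lambda>(i, j). \<phi> (fs2 ! i) (gs2 ! j))"
  have "mat (?n + ?m) (?n + ?m) (\<lambda>(i, j). \<phi> ((fs1 @ fs2) ! i) ((gs1 @ gs2) ! j))
      = four_block_mat ?A ?B (0\<^sub>m ?m ?n) ?D"
    using len orth by (intro eq_matI) (auto simp: nth_append)
  then show ?thesis
    unfolding gram_def using det_four_block_mat_lower_left_zero[of ?A ?n ?B ?m _ ?D] by simp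
qed

lemma gram_linear_last_row:
  assumes len: "length gs = Suc (length fs)"
    and lin: "\<And>g. g \<in> set gs \<Longrightarrow> \<phi> f g = c * \<phi> f1 g + d * \<phi> f2 g"
  shows "gram \<phi> (fs @ [f]) gs = c * gram \<phi> (fs @ [f1]) gs + d * gram \<phi> (fs @ [f2]) gs"
proof -
  let ?n = "length fs"
  define M where "M h = mat (Suc ?n) (Suc ?n) (\<lambda>(i, j). \<phi> ((fs @ [h]) ! i) (gs ! j))" for h
  have M: "M h \<in> carrier_mat (Suc ?n) (Suc ?n)" for h by (simp add: M_def)
  \<comment> \<open>Deleting the last row removes every entry that depends on
    \<open>h\<close>.\<close>
  have cof: "cofactor (M h) ?n j = cofactor (M f) ?n j" for h j
  proof -
    have "mat_delete (M h) ?n j = mat_delete (M f) ?n j"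
      by (rule eq_matI) (auto simp: mat_delete_def M_def nth_append)
    then show ?thesis by (simp add: cofactor_def)
  qed
  have det: "det (M h) = (\<Sum>j<Suc ?n. \<phi> h (gs ! j) * cofactor (M f) ?n j)" for h
    unfolding laplace_expansion_row[OF M[of h] lessI] cof[of h]
    by (intro sum.cong) (auto simp: M_def)
  have "det (M f) = c * det (M f1) + d * det (M f2)"
    unfolding det sum_distrib_left sum.distrib[symmetric]
    using len by (intro sum.cong) (auto simp: lin algebra_simps)
  then show ?thesis by (simp add: gram_def M_def)
qed

lemma gram_repeated_last_row:
  assumes "h \<in> set fs"
  shows "gram \<phi> (fs @ [h]) gs = 0"
proof -
  obtain i where i: "i < length fs" "fs ! i = h" using assms by (metis in_set_conv_nth)
  show ?thesis unfolding gram_def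
    by (rule det_identical_rows[of _ "Suc (length fs)" i "length fs"])
      (use i in \<open>auto intro!: eq_vecI simp: nth_append\<close>)
qed

text \<open>The repeated row \<open>h\<close> kills the \<open>d\<close> term. Doing this for the
  last row and, by symmetry, for the last column gives the factor \<open>c * c\<close>.\<close>

lemma gram_replace_last:
  assumes sym: "\<And>f g. \<phi> f g = \<phi> g f" and h: "h \<in> set fs" and c: "c * c = 1"
    and lin: "\<And>g. \<phi> f' g = c * \<phi> f g + d * \<phi> h g"
  shows "gram \<phi> (fs @ [f']) (fs @ [f']) = gram \<phi> (fs @ [f]) (fs @ [f])"
proof -
  have row: "gram \<phi> (fs @ [f']) gs = c * gram \<phi> (fs @ [f]) gs" if "length gs = Suc (length fs)" for gs
    using gram_linear_last_row[of gs fs \<phi> f' c f d h] that lin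
    by (simp add: gram_repeated_last_row[OF h])
  have "gram \<phi> (fs @ [f']) (fs @ [f']) = c * gram \<phi> (fs @ [f]) (fs @ [f'])"
    by (rule row) simp
  also have "gram \<phi> (fs @ [f]) (fs @ [f']) = gram \<phi> (fs @ [f']) (fs @ [f])"
    by (rule gram_commute) (simp_all add: sym)
  also have "\<dots> = c * gram \<phi> (fs @ [f]) (fs @ [f])"
    by (rule row) simp
  finally show ?thesis using c by (simp add: mult.assoc[symmetric])
qed

section \<open>Hankel determinants as Gram determinants of polynomials\<close>

definition moment :: "(nat \<Rightarrow> 'a :: comm_ring_1) \<Rightarrow> nat \<Rightarrow> 'a poly \<Rightarrow> 'a" where
  "moment a m q = (\<Sum>i\<le>degree q. coeff q i * a (m + i))"

lemma moment_bound:
  assumes "degree q \<le> N"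
  shows "moment a m q = (\<Sum>i\<le>N. coeff q i * a (m + i))"
  unfolding moment_def using assms
  by (intro sum.mono_neutral_left) (auto simp: coeff_eq_0)

lemma moment_0 [simp]: "moment a m 0 = 0"
  by (simp add: moment_def)

lemma moment_add: "moment a m (p + q) = moment a m p + moment a m q"
proof -
  let ?N = "max (degree p) (degree q)"
  have "degree (p + q) \<le> ?N" by (rule degree_add_le_max)
  then show ?thesis
    by (simp add: moment_bound[of _ ?N] sum.distrib distrib_right)
qed

lemma moment_smult: "moment a m (smult c q) = c * moment a m q"
  using moment_bound[OF degree_smult_le, of a m c q]
  by (simp add: moment_def sum_distrib_left mult.assoc)

lemma moment_pCons [simp]: "moment a m (pCons c q) = c * a m + moment a (Suc m) q"
proof -
  have "moment a m (pCons c q) = (\<Sum>i\<le>Suc (degree q). coeff (pCons c q) i * a (m + i))"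
    by (rule moment_bound) (simp add: degree_pCons_le)
  also have "\<dots> = c * a m + moment a (Suc m) q"
    by (subst sum.atMost_Suc_shift) (simp add: moment_def)
  finally show ?thesis .
qed

lemma moment_monom: "moment a m (monom 1 k) = a (m + k)"
  by (induction k arbitrary: m) (simp_all add: monom_0 monom_Suc)

definition hankel :: "(nat \<Rightarrow> 'a :: comm_ring_1) \<Rightarrow> nat \<Rightarrow> nat \<Rightarrow> 'a" where
  "hankel a n p = det (mat n n (\<lambda>(i, j). a (p + i + j)))"

text \<open>The pair \<open>(i, u)\<close> stands for the polynomial \<open>x ^ (s * i) * u\<close>, and the pairing of \<open>f\<close>
  and \<open>g\<close> is the value of the functional \<open>x ^ k \<mapsto> a k\<close> at \<open>x ^ (s * p + t) * f * g\<close>.\<close>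

fun pairing ::
  "(nat \<Rightarrow> 'a :: comm_ring_1) \<Rightarrow> nat \<Rightarrow> nat \<Rightarrow> nat \<Rightarrow> nat \<times> 'a poly \<Rightarrow> nat \<times> 'a poly \<Rightarrow> 'a" where
  "pairing a s t p (i, u) (j, v) = moment a (s * (p + i + j) + t) (u * v)"

lemma pairing_commute: "pairing a s t p f g = pairing a s t p g f"
  by (cases f; cases g) (simp add: mult.commute add.commute add.left_commute)

lemma pairing_linear:
  "pairing a s t p (i, smult c u + smult d v) g
    = c * pairing a s t p (i, u) g + d * pairing a s t p (i, v) g"
  by (cases g) (simp add: distrib_right moment_add moment_smult)

abbreviation gram_pairing where
  "gram_pairing a s t p fs \<equiv> gram (pairing a s t p) fs fs"

text \<open>The vectors x^(s*k) u for k < n; the stride s comes from the pairing.\<close>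

definition block :: "'a poly \<Rightarrow> nat \<Rightarrow> (nat \<times> ('a :: comm_ring_1) poly) list" where
  "block u n = map (\<lambda>k. (k, u)) [0..<n]"

lemma length_block [simp]: "length (block u n) = n"
  by (simp add: block_def)

lemma set_block [simp]: "set (block u n) = {..<n} \<times> {u}"
  by (auto simp: block_def)

lemma block_0 [simp]: "block u 0 = []"
  by (simp add: block_def)

lemma block_Suc: "block u (Suc n) = block u n @ [(n, u)]"
  by (simp add: block_def)

text \<open>Each multiple of \<open>v\<close> to be subtracted is itself in the list. The induction
  moves the top vector, once replaced, into \<open>fs\<close>, so \<open>fs\<close> must
  vary.\<close>

lemma gram_pairing_replace_block:
  assumes "\<And>k. k < n \<Longrightarrow> (k, v) \<in> set fs" "c * c = 1"
  shows "gram_pairing a s t p (block (smult c u + smult d v) n @ fs)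
    = gram_pairing a s t p (block u n @ fs)"
  using assms(1)
proof (induction n arbitrary: fs)
  case 0
  then show ?case by simp
next
  case (Suc n)
  let ?u = "smult c u + smult d v"
  have "gram_pairing a s t p (block ?u (Suc n) @ fs)
      = gram_pairing a s t p ((block ?u n @ fs) @ [(n, ?u)])"
    by (rule gram_mset_cong) (simp add: block_Suc)
  also have "\<dots> = gram_pairing a s t p ((block ?u n @ fs) @ [(n, u)])"
    by (rule gram_replace_last[where \<phi> = "pairing a s t p" and h = "(n, v)",
          OF pairing_commute _ assms(2) pairing_linear]) (simp add: Suc.prems)
  also have "\<dots> = gram_pairing a s t p (block ?u n @ (fs @ [(n, u)]))"
    by simp
  also have "\<dots> = gram_pairing a s t p (block u n @ (fs @ [(n, u)]))"
    by (rule Suc.IH) (use Suc.prems in auto)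
  also have "\<dots> = gram_pairing a s t p (block u (Suc n) @ fs)"
    by (rule gram_mset_cong) (simp add: block_Suc)
  finally show ?case .
qed

text \<open>A triangular change of basis. Block sizes decrease with the degree, so every lower
  polynomial needed to clear a coefficient occurs with the same power of x^s.\<close>

lemma gram_pairing_triangular:
  assumes "n2 \<le> n1" "n1 \<le> n0" "b1 * b1 = 1" "c2 * c2 = 1"
  shows "gram_pairing a s t p (block [:1:] n0 @ block [:b0, b1:] n1 @ block [:c0, c1, c2:] n2)
    = gram_pairing a s t p (block [:1:] n0 @ block [:0, 1:] n1 @ block [:0, 0, 1:] n2)"
    (is "?G (?A @ ?B' @ ?C') = ?G (?A @ ?B @ ?C)")
proof -
  let ?C1 = "block [:c0, 0, c2:] n2"
  have "?G (?A @ ?B' @ ?C') = ?G (?B' @ (?A @ ?C'))"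
    by (rule gram_mset_cong) simp
  also have "?B' = block (smult b1 [:0, 1:] + smult b0 [:1:]) n1"
    by simp
  also have "?G (block (smult b1 [:0, 1:] + smult b0 [:1:]) n1 @ (?A @ ?C')) = ?G (?B @ (?A @ ?C'))"
    by (rule gram_pairing_replace_block) (use assms in auto)
  also have "\<dots> = ?G (?C' @ (?A @ ?B))"
    by (rule gram_mset_cong) simp
  also have "?C' = block (smult 1 [:c0, 0, c2:] + smult c1 [:0, 1:]) n2"
    by simp
  also have "?G (\<dots> @ (?A @ ?B)) = ?G (?C1 @ (?A @ ?B))"
    by (rule gram_pairing_replace_block) (use assms in auto)
  also have "?C1 = block (smult c2 [:0, 0, 1:] + smult c0 [:1:]) n2"
    by simp
  also have "?G (\<dots> @ (?A @ ?B)) = ?G (?C @ (?A @ ?B))"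
    by (rule gram_pairing_replace_block) (use assms in auto)
  also have "\<dots> = ?G (?A @ ?B @ ?C)"
    by (rule gram_mset_cong) simp
  finally show ?thesis by simp
qed

section \<open>Splitting the powers of x by the residue of the exponent\<close>

lemma hankel_eq_gram_pairing_map:
  assumes "s > 0"
  shows "hankel a n (s * p + t)
    = gram_pairing a s t p (map (\<lambda>i. (i div s, monom 1 (i mod s))) [0..<n])"
proof -
  have idx: "s * (p + i div s + j div s) + t + (i mod s + j mod s) = s * p + t + i + j" for i j
    using mult_div_mod_eq[of s i] mult_div_mod_eq[of s j] by (simp add: algebra_simps)
  show ?thesis
    unfolding hankel_def gram_def
    by (intro arg_cong[of _ _ det] eq_matI) (auto simp: mult_monom moment_monom idx)
qed

lemma monom_1_numeral: "monom (1 :: 'a :: comm_ring_1) 0 = [:1:]"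
  "monom (1 :: 'a) (Suc 0) = [:0, 1:]" "monom (1 :: 'a) 2 = [:0, 0, 1:]"
  by (simp_all add: monom_0 monom_Suc numeral_2_eq_2)

lemma mod_3_cases:
  fixes n :: nat
  obtains k where "n = 3 * k" | k where "n = 3 * k + 1" | k where "n = 3 * k + 2"
proof -
  have "n mod 3 = 0 \<or> n mod 3 = 1 \<or> n mod 3 = 2" by auto
  then show ?thesis
    using mult_div_mod_eq[of 3 n] that by (metis add.right_neutral)
qed

lemma mset_blocks_3:
  "mset (map (\<lambda>i. (i div 3, monom 1 (i mod 3))) [0..<n])
    = mset (block [:1:] ((n + 2) div 3) @ block [:0, 1:] ((n + 1) div 3)
        @ block [:0, 0, 1 :: 'a :: comm_ring_1:] (n div 3))"
proof (induction n)
  case 0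
  then show ?case by simp
next
  case (Suc n)
  show ?case
  proof (cases n rule: mod_3_cases)
    case (1 k)
    then have "Suc n div 3 = k" "(Suc n + 1) div 3 = k" "(Suc n + 2) div 3 = Suc k"
      "n div 3 = k" "(n + 1) div 3 = k" "(n + 2) div 3 = k" "n mod 3 = 0" by presburger+
    with Suc.IH show ?thesis by (simp add: block_Suc monom_1_numeral)
  next
    case (2 k)
    then have "Suc n div 3 = k" "(Suc n + 1) div 3 = Suc k" "(Suc n + 2) div 3 = Suc k"
      "n div 3 = k" "(n + 1) div 3 = k" "(n + 2) div 3 = Suc k" "n mod 3 = 1" by presburger+
    with Suc.IH show ?thesis by (simp add: block_Suc monom_1_numeral)
  next
    case (3 k)
    then have "Suc n div 3 = Suc k" "(Suc n + 1) div 3 = Suc k" "(Suc n + 2) div 3 = Suc k"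
      "n div 3 = k" "(n + 1) div 3 = Suc k" "(n + 2) div 3 = Suc k" "n mod 3 = 2" by presburger+
    with Suc.IH show ?thesis by (simp add: block_Suc monom_1_numeral)
  qed
qed

lemma mset_blocks_2:
  "mset (map (\<lambda>i. (i div 2, monom 1 (i mod 2))) [0..<n])
    = mset (block [:1:] ((n + 1) div 2) @ block [:0, 1 :: 'a :: comm_ring_1:] (n div 2))"
proof (induction n)
  case 0
  then show ?case by simp
next
  case (Suc n)
  show ?case
  proof (cases "even n")
    case True
    then obtain k where "n = 2 * k" by (rule evenE)
    with Suc.IH show ?thesis by (simp add: block_Suc monom_1_numeral)
  next
    case False
    then obtain k where "n = 2 * k + 1" by (rule oddE)
    with Suc.IH show ?thesis by (simp add: block_Suc monom_1_numeral)
  qed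
qed

lemma hankel_eq_gram_pairing_3:
  assumes "b1 * b1 = 1" "c2 * c2 = 1"
  shows "hankel a n (3 * p + t) = gram_pairing a 3 t p
    (block [:1:] ((n + 2) div 3) @ block [:b0, b1:] ((n + 1) div 3) @ block [:c0, c1, c2:] (n div 3))"
proof -
  have "n div 3 \<le> (n + 1) div 3" "(n + 1) div 3 \<le> (n + 2) div 3" by presburger+
  note gram_pairing_triangular[OF this assms]
  also have "gram_pairing a 3 t p (block [:1:] ((n + 2) div 3) @ block [:0, 1:] ((n + 1) div 3)
      @ block [:0, 0, 1:] (n div 3)) = hankel a n (3 * p + t)"
    unfolding hankel_eq_gram_pairing_map[OF zero_less_numeral]
    by (rule gram_mset_cong) (rule mset_blocks_3[symmetric])
  finally show ?thesis by (rule sym)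
qed

lemma hankel_eq_gram_pairing_2:
  assumes "b1 * b1 = 1"
  shows "hankel a n (2 * p + t) = gram_pairing a 2 t p
    (block [:1:] ((n + 1) div 2) @ block [:b0, b1:] (n div 2))"
proof -
  have "n div 2 \<le> (n + 1) div 2" by presburger
  then have "gram_pairing a 2 t p (block [:1:] ((n + 1) div 2) @ block [:b0, b1:] (n div 2))
    = gram_pairing a 2 t p (block [:1:] ((n + 1) div 2) @ block [:0, 1:] (n div 2))"
    using gram_pairing_triangular[of 0 "n div 2" "(n + 1) div 2" b1 1 a 2 t p b0] assms by simp
  also have "\<dots> = hankel a n (2 * p + t)"
    unfolding hankel_eq_gram_pairing_map[OF pos2]
    by (rule gram_mset_cong) (rule mset_blocks_2[symmetric])
  finally show ?thesis by (rule sym)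
qed

section \<open>Orthogonal blocks\<close>

definition orth :: "(nat \<Rightarrow> 'a :: comm_ring_1) \<Rightarrow> nat \<Rightarrow> nat \<Rightarrow> 'a poly \<Rightarrow> 'a poly \<Rightarrow> bool" where
  "orth a s t u v \<longleftrightarrow> (\<forall>m. moment a (s * m + t) (u * v) = 0)"

lemma orth_commute: "orth a s t u v \<longleftrightarrow> orth a s t v u"
  by (simp add: orth_def mult.commute)

lemma pairing_eq_0: "orth a s t u v \<Longrightarrow> pairing a s t p (i, u) (j, v) = 0"
  by (simp add: orth_def)

text \<open>Self-similarity enters here: if the moments of u^2 along a residue class are a multiple
  of a shifted sequence, the Gram matrix is a scaled Hankel matrix.\<close>

lemma gram_pairing_block:
  assumes "\<And>m. moment a (s * m + t) (u * u) = c * b (m + q)"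
  shows "gram_pairing a s t p (block u n) = c ^ n * hankel b n (p + q)"
proof -
  let ?H = "mat n n (\<lambda>(i, j). b (p + q + i + j))"
  have idx: "p + i + j + q = p + q + i + j" for i j by simp
  have "mat n n (\<lambda>(i, j). pairing a s t p (block u n ! i) (block u n ! j)) = c \<cdot>\<^sub>m ?H"
    by (rule eq_matI) (simp_all add: block_def assms idx)
  then show ?thesis
    by (simp add: gram_def hankel_def det_smult)
qed

lemma gram_pairing_orth:
  fixes a :: "nat \<Rightarrow> 'a :: idom"
  assumes "\<And>i u j v. (i, u) \<in> set fs \<Longrightarrow> (j, v) \<in> set gs \<Longrightarrow> orth a s t u v"
  shows "gram_pairing a s t p (fs @ gs) = gram_pairing a s t p fs * gram_pairing a s t p gs"
proof (rule gram_append)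
  fix f g
  assume "f \<in> set gs" "g \<in> set fs"
  then have "pairing a s t p g f = 0"
    using assms by (metis pairing_eq_0 surj_pair)
  then show "pairing a s t p f g = 0"
    by (simp only: pairing_commute)
qed simp_all

lemma gram_pairing_pair:
  fixes a :: "nat \<Rightarrow> 'a :: idom"
  assumes "orth a s t v w"
  shows "gram_pairing a s t p (block (v + smult c w) n @ block w n)
    = gram_pairing a s t p (block v n) * gram_pairing a s t p (block w n)"
  using gram_pairing_replace_block[of n w "block w n" 1 a s t p v c]
    gram_pairing_orth[of "block v n" "block w n" a s t p] assms
  by simp

text \<open>Only the top vector x^(s*n) (v + c w) has no matching copy of w to subtract. Expanding
  it in rows and columns leaves a v-v term and a w-w term with factor c^2; mixed terms vanish by
  orthogonality.\<close>

lemma gram_pairing_glue: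
  fixes a :: "nat \<Rightarrow> 'a :: idom"
  assumes vw: "orth a s t v w"
  shows "gram_pairing a s t p (block (v + smult c w) (Suc n) @ block w n)
    = gram_pairing a s t p (block v (Suc n)) * gram_pairing a s t p (block w n)
    + c * c * gram_pairing a s t p (block v n) * gram_pairing a s t p (block w (Suc n))"
proof -
  let ?f = "(n, v + smult c w)"
  let ?V = "block v n" and ?W = "block w n"
  let ?g = "gram (pairing a s t p)"
  have wv: "orth a s t w v" using vw by (simp add: orth_commute)
  have f: "pairing a s t p ?f g = 1 * pairing a s t p (n, v) g + c * pairing a s t p (n, w) g" for g
    using pairing_linear[of a s t p n 1 v c w g] by simp
  have "gram_pairing a s t p (block (v + smult c w) (Suc n) @ ?W)
      = gram_pairing a s t p (block (smult 1 v + smult c w) n @ (?W @ [?f]))"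
    by (rule gram_mset_cong) (simp add: block_Suc)
  also have "\<dots> = gram_pairing a s t p (?V @ (?W @ [?f]))"
    by (rule gram_pairing_replace_block) auto
  also have "\<dots> = ?g (?W @ ?V @ [?f]) (?W @ ?V @ [?f])"
    by (rule gram_mset_cong) simp
  also have "\<dots> = ?g (?W @ ?V @ [(n, v)]) (?W @ ?V @ [?f])
      + c * ?g (?W @ ?V @ [(n, w)]) (?W @ ?V @ [?f])"
    using gram_linear_last_row[of "?W @ ?V @ [?f]" "?W @ ?V" "pairing a s t p" ?f 1 "(n, v)" c "(n, w)"] f
    by simp
  \<comment> \<open>Rows in v against columns in w vanish; the w part of the last column only
    affects the upper right block.\<close>
  also have "?g (?W @ ?V @ [(n, v)]) (?W @ ?V @ [?f])
      = ?g ?W ?W * ?g (?V @ [(n, v)]) (?V @ [?f])"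
    by (rule gram_append) (use vw in \<open>auto intro: pairing_eq_0 simp del: pairing.simps\<close>)
  also have "?g (?V @ [(n, v)]) (?V @ [?f]) = ?g (?V @ [?f]) (?V @ [(n, v)])"
    by (rule gram_commute) (simp_all add: pairing_commute)
  also have "\<dots> = ?g (?V @ [(n, v)]) (?V @ [(n, v)])"
    by (subst gram_linear_last_row[of _ _ _ _ 1 "(n, v)" 0 "(n, v)"])
      (auto simp: f pairing_eq_0[OF wv] simp del: pairing.simps)
  \<comment> \<open>Now the top row belongs to w, so the v block goes first to make the lower left
    block vanish again.\<close>
  also have "?g (?W @ ?V @ [(n, w)]) (?W @ ?V @ [?f]) = ?g (?V @ ?W @ [(n, w)]) (?V @ ?W @ [?f])"
    by (rule gram_swap_blocks) simp_all
  also have "\<dots> = ?g ?V ?V * ?g (?W @ [(n, w)]) (?W @ [?f])"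
    by (rule gram_append) (use wv in \<open>auto intro: pairing_eq_0 simp del: pairing.simps\<close>)
  also have "?g (?W @ [(n, w)]) (?W @ [?f]) = ?g (?W @ [?f]) (?W @ [(n, w)])"
    by (rule gram_commute) (simp_all add: pairing_commute)
  also have "\<dots> = c * ?g (?W @ [(n, w)]) (?W @ [(n, w)])"
    by (subst gram_linear_last_row[of _ _ _ _ 0 "(n, w)" c "(n, w)"])
      (auto simp: f pairing_eq_0[OF vw] simp del: pairing.simps)
  finally show ?thesis by (simp add: block_Suc algebra_simps)
qed

text \<open>The Gram determinant of \<open>v + c w\<close> in degrees \<open>< m\<close> and \<open>w\<close> in degrees \<open>< n\<close> for orthogonal
  \<open>v\<close>, \<open>w\<close>, in terms of those of \<open>v\<close> and \<open>w\<close>; meaningful only for \<open>m \<in> {n, n + 1}\<close> and \<open>c\<^sup>2 = 1\<close>.\<close>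

definition glue :: "(nat \<Rightarrow> 'a :: comm_ring_1) \<Rightarrow> (nat \<Rightarrow> 'a) \<Rightarrow> nat \<Rightarrow> nat \<Rightarrow> 'a" where
  "glue V W m n = (if m = n then V n * W n else V m * W n + V n * W m)"

lemma glue_cong:
  assumes "V n = V' n'" "V (n + r) = V' (n' + r)" "W n = W' n'" "W (n + r) = W' (n' + r)"
  shows "glue V W (n + r) n = glue V' W' (n' + r) n'"
  using assms by (simp add: glue_def)

lemma gram_pairing_glue_cases:
  fixes a :: "nat \<Rightarrow> 'a :: idom"
  assumes "orth a s t v w" "c * c = 1" "m = n \<or> m = Suc n"
  shows "gram_pairing a s t p (block (v + smult c w) m @ block w n)
    = glue (\<lambda>k. gram_pairing a s t p (block v k)) (\<lambda>k. gram_pairing a s t p (block w k)) m n"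
  using assms(3) gram_pairing_pair[OF assms(1)] gram_pairing_glue[OF assms(1)]
  by (auto simp: glue_def assms(2))

lemma gram_pairing_orth_glue:
  fixes a :: "nat \<Rightarrow> 'a :: idom"
  assumes "orth a s t v w" "orth a s t f v" "orth a s t f w" "c * c = 1" "m = n \<or> m = Suc n"
  shows "gram_pairing a s t p (block f l @ block (v + smult c w) m @ block w n)
    = gram_pairing a s t p (block f l)
    * glue (\<lambda>k. gram_pairing a s t p (block v k)) (\<lambda>k. gram_pairing a s t p (block w k)) m n"
proof -
  have "orth a s t f (v + smult c w)"
    using assms(2,3) by (simp add: orth_def distrib_left moment_add moment_smult)
  then show ?thesis
    using assms gram_pairing_orth[of "block f l" "block (v + smult c w) m @ block w n" a s t p]
    by (auto simp: gram_pairing_glue_cases)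
qed

section \<open>Splitting by the parity of the index\<close>

text \<open>The product of 1 and x meets only odd indices, and x * x accounts for the shift by
  1.\<close>

lemma hankel_even_shift:
  fixes a :: "nat \<Rightarrow> F3"
  assumes odd: "\<And>m. a (Suc (2 * m)) = 0"
  shows "hankel a n (2 * p)
    = hankel (\<lambda>m. a (2 * m)) ((n + 1) div 2) p * hankel (\<lambda>m. a (2 * m)) (n div 2) (p + 1)"
proof -
  have 1: "orth a 2 0 [:1:] [:0, 1:]"
    by (simp add: orth_def odd)
  have 2: "gram_pairing a 2 0 p (block [:1:] k) = 1 ^ k * hankel (\<lambda>m. a (2 * m)) k (p + 0)" for k
    by (rule gram_pairing_block) simp
  have 3: "gram_pairing a 2 0 p (block [:0, 1:] k) = 1 ^ k * hankel (\<lambda>m. a (2 * m)) k (p + 1)" for k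
    by (rule gram_pairing_block) simp
  have "hankel a n (2 * p + 0)
      = gram_pairing a 2 0 p (block [:1:] ((n + 1) div 2) @ block [:0, 1:] (n div 2))"
    by (rule hankel_eq_gram_pairing_2) simp
  also have "\<dots> = gram_pairing a 2 0 p (block [:1:] ((n + 1) div 2))
      * gram_pairing a 2 0 p (block [:0, 1:] (n div 2))"
    by (rule gram_pairing_orth) (use 1 in auto)
  finally show ?thesis by (simp add: 2 3)
qed

text \<open>With an odd shift only odd powers in a product contribute. (1 + x)(1 - x) has none,
  while (1 + x)^2 and (1 - x)^2 contribute 2x = -x and -2x = x modulo 3.\<close>

lemma hankel_odd_shift:
  fixes a :: "nat \<Rightarrow> F3"
  assumes odd: "\<And>m. a (Suc (2 * m)) = 0"
  defines "b \<equiv> \<lambda>m. a (2 * m)"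
  shows "hankel a n (2 * p + 1)
    = glue (\<lambda>k. (- 1) ^ k * hankel b k (p + 1)) (\<lambda>k. hankel b k (p + 1)) ((n + 1) div 2) (n div 2)"
proof -
  have odd': "a (Suc (Suc (Suc (2 * m)))) = 0" for m using odd[of "Suc m"] by simp
  have 1: "orth a 2 1 [:- 1, - 1:] [:1, - 1:]"
    by (simp add: orth_def odd odd')
  have 2: "gram_pairing a 2 1 p (block [:- 1, - 1:] k) = (- 1) ^ k * hankel b k (p + 1)" for k
    by (rule gram_pairing_block) (simp add: odd odd' b_def)
  have 3: "gram_pairing a 2 1 p (block [:1, - 1:] k) = 1 ^ k * hankel b k (p + 1)" for k
    by (rule gram_pairing_block) (simp add: odd odd' b_def)
  have "hankel a n (2 * p + 1)
      = gram_pairing a 2 1 p (block [:1:] ((n + 1) div 2) @ block [:1, - 1:] (n div 2))"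
    by (rule hankel_eq_gram_pairing_2) simp
  \<comment> \<open>The constants sum to -2, which is 1 modulo 3.\<close>
  also have "[:1:] = [:- 1, - 1:] + smult (- 1) [:1, - 1 :: F3:]"
    by simp
  also have "gram_pairing a 2 1 p (block \<dots> ((n + 1) div 2) @ block [:1, - 1:] (n div 2))
      = glue (\<lambda>k. gram_pairing a 2 1 p (block [:- 1, - 1:] k))
          (\<lambda>k. gram_pairing a 2 1 p (block [:1, - 1:] k)) ((n + 1) div 2) (n div 2)"
    by (rule gram_pairing_glue_cases[OF 1]) (simp, presburger)
  finally show ?thesis unfolding 2 3 by simp
qed

section \<open>Recurrences for the Cantor sequence\<close>

text \<open>\<open>cantor n\<close> is nonzero only if no ternary digit of \<open>n\<close> is 1,
  and such \<open>n\<close> are even.\<close>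

lemma cantor_odd: "cantor (2 * m + 1) = 0"
proof (induction m rule: less_induct)
  case (less m)
  show ?case
  proof (cases m rule: mod_3_cases)
    case (1 j)
    then have "2 * m + 1 = 3 * (2 * j) + 1" by simp
    then show ?thesis by (simp only: cantor_rec)
  next
    case (2 j)
    then have "2 * m + 1 = 3 * (2 * j + 1)" by simp
    then have "cantor (2 * m + 1) = cantor (2 * j + 1)" by (simp only: cantor_rec)
    then show ?thesis using less.IH[of j] 2 by simp
  next
    case (3 j)
    then have "2 * m + 1 = 3 * (2 * j + 1) + 2" by simp
    then have "cantor (2 * m + 1) = cantor (2 * j + 1)" by (simp only: cantor_rec)
    then show ?thesis using less.IH[of j] 3 by simp
  qed
qed

lemma cantor_d_odd: "cantor_d (2 * m + 1) = 0"
proof -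
  have "2 * m + 1 + 2 = 2 * (m + 1) + 1" by simp
  then show ?thesis
    unfolding cantor_d_def by (simp only: cantor_odd)
qed

text \<open>The indicator of the numbers whose ternary digits are all 0 or 1.\<close>

definition cantor_b :: "nat \<Rightarrow> F3" where
  "cantor_b m = of_int (cantor (2 * m))"

definition cantor_e :: "nat \<Rightarrow> F3" where
  "cantor_e m = of_int (cantor_d (2 * m))"

lemma cantor_e_eq: "cantor_e m = cantor_b m + cantor_b (Suc m)"
proof -
  have "2 * m + 2 = 2 * Suc m" by simp
  then show ?thesis by (simp add: cantor_e_def cantor_b_def cantor_d_def)
qed

lemma cantor_b_base: "cantor_b (3 * m) = cantor_b m" "cantor_b (Suc (3 * m)) = cantor_b m" "cantor_b (Suc (Suc (3 * m))) = 0"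
proof -
  have "2 * (3 * m) = 3 * (2 * m)" "2 * Suc (3 * m) = 3 * (2 * m) + 2"
    "2 * Suc (Suc (3 * m)) = 3 * (2 * m + 1) + 1"
    by simp_all
  then show "cantor_b (3 * m) = cantor_b m" "cantor_b (Suc (3 * m)) = cantor_b m" "cantor_b (Suc (Suc (3 * m))) = 0"
    unfolding cantor_b_def by (simp_all only: cantor_rec of_int_0)
qed

text \<open>Nested \<open>Suc\<close> matches the output of \<open>moment_pCons\<close>. The largest
  offset 7 is shift 2, plus degree 4 of a square, plus 1 from \<open>cantor_e_eq\<close>.\<close>

lemma cantor_b_rec:
  "cantor_b (3 * m) = cantor_b m" "cantor_b (Suc (3 * m)) = cantor_b m" "cantor_b (Suc (Suc (3 * m))) = 0"
  "cantor_b (Suc (Suc (Suc (3 * m)))) = cantor_b (Suc m)"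
  "cantor_b (Suc (Suc (Suc (Suc (3 * m))))) = cantor_b (Suc m)"
  "cantor_b (Suc (Suc (Suc (Suc (Suc (3 * m)))))) = 0"
  "cantor_b (Suc (Suc (Suc (Suc (Suc (Suc (3 * m))))))) = cantor_b (Suc (Suc m))"
  "cantor_b (Suc (Suc (Suc (Suc (Suc (Suc (Suc (3 * m)))))))) = cantor_b (Suc (Suc m))"
proof -
  have "3 * Suc k = Suc (Suc (Suc (3 * k)))" for k by simp
  note Suc = cantor_b_base[of "Suc m", unfolded this] cantor_b_base[of "Suc (Suc m)", unfolded this]
  show "cantor_b (3 * m) = cantor_b m" "cantor_b (Suc (3 * m)) = cantor_b m" "cantor_b (Suc (Suc (3 * m))) = 0"
    "cantor_b (Suc (Suc (Suc (3 * m)))) = cantor_b (Suc m)"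
    "cantor_b (Suc (Suc (Suc (Suc (3 * m))))) = cantor_b (Suc m)"
    "cantor_b (Suc (Suc (Suc (Suc (Suc (3 * m)))))) = 0"
    "cantor_b (Suc (Suc (Suc (Suc (Suc (Suc (3 * m))))))) = cantor_b (Suc (Suc m))"
    "cantor_b (Suc (Suc (Suc (Suc (Suc (Suc (Suc (3 * m)))))))) = cantor_b (Suc (Suc m))"
    by (rule cantor_b_base Suc)+
qed

section \<open>The six ternary recurrences\<close>

lemmas moment_eval = orth_def cantor_b_rec cantor_e_eq numeral_2_eq_2

text \<open>Here \<open>{f, v + c w, w}\<close> is, up to order, a basis of the polynomials of degree at most 2 whose
  members have degrees 0, 1 and 2, while \<open>{f, v, w}\<close> is the orthogonal basis.\<close>

lemma hankel_ternary:
  fixes a :: "nat \<Rightarrow> 'a :: idom"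
  assumes "b\<^sub>1 * b\<^sub>1 = 1" "c\<^sub>2 * c\<^sub>2 = 1" "c * c = 1" "m = k \<or> m = Suc k"
    and blocks: "mset (block [:1:] ((n + 2) div 3) @ block [:b\<^sub>0, b\<^sub>1:] ((n + 1) div 3)
        @ block [:c\<^sub>0, c\<^sub>1, c\<^sub>2:] (n div 3))
      = mset (block f l @ block (v + smult c w) m @ block w k)"
    and orth: "orth a 3 t v w" "orth a 3 t f v" "orth a 3 t f w"
    and f: "\<And>i. moment a (3 * i + t) (f * f) = c\<^sub>f * a\<^sub>f (i + q\<^sub>f)"
    and v: "\<And>i. moment a (3 * i + t) (v * v) = c\<^sub>v * a\<^sub>v (i + q\<^sub>v)"
    and w: "\<And>i. moment a (3 * i + t) (w * w) = c\<^sub>w * a\<^sub>w (i + q\<^sub>w)"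
  shows "hankel a n (3 * p + t) = c\<^sub>f ^ l * hankel a\<^sub>f l (p + q\<^sub>f)
    * glue (\<lambda>i. c\<^sub>v ^ i * hankel a\<^sub>v i (p + q\<^sub>v)) (\<lambda>i. c\<^sub>w ^ i * hankel a\<^sub>w i (p + q\<^sub>w)) m k"
proof -
  let ?G = "gram_pairing a 3 t p"
  have "hankel a n (3 * p + t) = ?G (block f l @ block (v + smult c w) m @ block w k)"
    using hankel_eq_gram_pairing_3[OF assms(1,2)] gram_mset_cong[OF blocks] by (rule trans)
  also have "\<dots> = ?G (block f l) * glue (\<lambda>i. ?G (block v i)) (\<lambda>i. ?G (block w i)) m k"
    by (rule gram_pairing_orth_glue[OF orth assms(3,4)])
  finally show ?thesis
    by (simp only: gram_pairing_block[of a 3 t, OF f] gram_pairing_block[of a 3 t, OF v]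
        gram_pairing_block[of a 3 t, OF w])
qed

text \<open>Modulo 3, \<open>[:1, - 1, 1:]\<close> is (1 + x)^2, whose square (1 + x)(1 + x^3) adds
  neighbouring terms of \<open>cantor_b\<close> and so produces \<open>cantor_e\<close>, for each
  shift residue. The degree d slot has size (n + 2 - d) div 3; here v - w = 1 - x fills degree
  1.\<close>

lemma hankel_cantor_b_0:
  "hankel cantor_b n (3 * p + 0) = hankel cantor_b ((n + 2) div 3) p
    * glue (\<lambda>k. (- 1) ^ k * hankel cantor_e k p) (\<lambda>k. hankel cantor_b k (p + 1))
        ((n + 1) div 3) (n div 3)"
  by (rule hankel_ternary[where f = "[:1:]" and v = "[:1, - 1, 1:]" and w = "[:0, 0, 1:]" and c = "- 1"
        and b\<^sub>0 = 1 and b\<^sub>1 = "- 1" and c\<^sub>0 = 0 and c\<^sub>1 = 0 and c\<^sub>2 = 1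
        and c\<^sub>f = 1 and a\<^sub>f = cantor_b and q\<^sub>f = 0 and c\<^sub>v = "- 1" and a\<^sub>v = cantor_e and q\<^sub>v = 0
        and c\<^sub>w = 1 and a\<^sub>w = cantor_b and q\<^sub>w = 1, THEN trans])
    (simp_all add: moment_eval, presburger?)

text \<open>Both \<open>v\<close> and \<open>w\<close> have degree 2, and v - w = 1 fills degree
  0.\<close>

lemma hankel_cantor_b_1:
  "hankel cantor_b n (3 * p + 1) = hankel cantor_b ((n + 1) div 3) (p + 1)
    * glue (\<lambda>k. hankel cantor_e k p) (\<lambda>k. (- 1) ^ k * hankel cantor_b k (p + 1))
        ((n + 2) div 3) (n div 3)"
  by (rule hankel_ternary[where f = "[:0, 1:]" and v = "[:1, - 1, 1:]" and w = "[:0, - 1, 1:]" and c = "- 1"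
        and b\<^sub>0 = 0 and b\<^sub>1 = 1 and c\<^sub>0 = 0 and c\<^sub>1 = "- 1" and c\<^sub>2 = 1
        and c\<^sub>f = 1 and a\<^sub>f = cantor_b and q\<^sub>f = 1 and c\<^sub>v = 1 and a\<^sub>v = cantor_e and q\<^sub>v = 0
        and c\<^sub>w = "- 1" and a\<^sub>w = cantor_b and q\<^sub>w = 1, THEN trans])
    (simp_all add: moment_eval, presburger?)

text \<open>Both \<open>v\<close> and \<open>w\<close> have degree 1, and v + w = 1 fills degree
  0.\<close>

lemma hankel_cantor_b_2:
  "hankel cantor_b n (3 * p + 2) = hankel cantor_e (n div 3) (p + 1)
    * glue (\<lambda>k. (- 1) ^ k * hankel cantor_b k (p + 1)) (\<lambda>k. hankel cantor_b k (p + 1))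
        ((n + 2) div 3) ((n + 1) div 3)"
  by (rule hankel_ternary[where f = "[:1, - 1, 1:]" and v = "[:1, - 1:]" and w = "[:0, 1:]" and c = 1
        and b\<^sub>0 = 0 and b\<^sub>1 = 1 and c\<^sub>0 = 1 and c\<^sub>1 = "- 1" and c\<^sub>2 = 1
        and c\<^sub>f = 1 and a\<^sub>f = cantor_e and q\<^sub>f = 1 and c\<^sub>v = "- 1" and a\<^sub>v = cantor_b and q\<^sub>v = 1
        and c\<^sub>w = 1 and a\<^sub>w = cantor_b and q\<^sub>w = 1, THEN trans])
    (simp_all add: moment_eval, presburger?)

text \<open>The functional of \<open>cantor_e\<close> is that of \<open>cantor_b\<close> after
  multiplication by 1 + x. This factor times the square of a multiple of 1 + x contains (1 + x)^3 =
  1 + x^3, which reproduces \<open>cantor_e\<close>. Here v - w = 1 fills degree 0.\<close>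

lemma hankel_cantor_e_0:
  "hankel cantor_e n (3 * p + 0) = hankel cantor_e ((n + 1) div 3) p
    * glue (\<lambda>k. hankel cantor_b k (p + 1)) (\<lambda>k. (- 1) ^ k * hankel cantor_e k p)
        ((n + 2) div 3) (n div 3)"
  by (rule hankel_ternary[where f = "[:1, 1:]" and v = "[:0, 0, 1:]" and w = "[:- 1, 0, 1:]" and c = "- 1"
        and b\<^sub>0 = 1 and b\<^sub>1 = 1 and c\<^sub>0 = "- 1" and c\<^sub>1 = 0 and c\<^sub>2 = 1
        and c\<^sub>f = 1 and a\<^sub>f = cantor_e and q\<^sub>f = 0 and c\<^sub>v = 1 and a\<^sub>v = cantor_b and q\<^sub>v = 1
        and c\<^sub>w = "- 1" and a\<^sub>w = cantor_e and q\<^sub>w = 0, THEN trans])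
    (simp_all add: moment_eval, presburger?)

lemma hankel_cantor_e_1:
  "hankel cantor_e n (3 * p + 1) = hankel cantor_e (n div 3) (p + 1)
    * glue (\<lambda>k. hankel cantor_e k p) (\<lambda>k. (- 1) ^ k * hankel cantor_b k (p + 1))
        ((n + 2) div 3) ((n + 1) div 3)"
  by (rule hankel_ternary[where f = "[:0, 1, 1:]" and v = "[:1, 1:]" and w = "[:0, 1:]" and c = "- 1"
        and b\<^sub>0 = 0 and b\<^sub>1 = 1 and c\<^sub>0 = 0 and c\<^sub>1 = 1 and c\<^sub>2 = 1
        and c\<^sub>f = 1 and a\<^sub>f = cantor_e and q\<^sub>f = 1 and c\<^sub>v = 1 and a\<^sub>v = cantor_e and q\<^sub>v = 0
        and c\<^sub>w = "- 1" and a\<^sub>w = cantor_b and q\<^sub>w = 1, THEN trans])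
    (simp_all add: moment_eval, presburger?)

text \<open>Here v - w = 1 + x fills degree 1.\<close>

lemma hankel_cantor_e_2:
  "hankel cantor_e n (3 * p + 2) = hankel cantor_b ((n + 2) div 3) (p + 1)
    * glue (\<lambda>k. hankel cantor_e k (p + 1)) (\<lambda>k. (- 1) ^ k * hankel cantor_e k (p + 1))
        ((n + 1) div 3) (n div 3)"
  by (rule hankel_ternary[where f = "[:1:]" and v = "[:0, 1, 1:]" and w = "[:- 1, 0, 1:]" and c = "- 1"
        and b\<^sub>0 = 1 and b\<^sub>1 = 1 and c\<^sub>0 = "- 1" and c\<^sub>1 = 0 and c\<^sub>2 = 1
        and c\<^sub>f = 1 and a\<^sub>f = cantor_b and q\<^sub>f = 1 and c\<^sub>v = 1 and a\<^sub>v = cantor_e and q\<^sub>v = 1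
        and c\<^sub>w = "- 1" and a\<^sub>w = cantor_e and q\<^sub>w = 1, THEN trans])
    (simp_all add: moment_eval, presburger?)

section \<open>Automaticity\<close>

text \<open>A representative position is chosen for each state; the morphism reads off the block of
  states below it, and the coding its value of \<open>u\<close>. By \<open>step\<close> and
  \<open>out\<close> the choice is immaterial. The injection \<open>e\<close> makes states into
  letters in \<open>nat\<close>.\<close>

lemma automatic2I:
  fixes v :: "nat \<Rightarrow> nat \<Rightarrow> 's"
  assumes k: "k > 0" and fin: "finite (range (\<lambda>(m, n). v m n))"
    and step: "\<And>m n m' n' r s. v m n = v m' n' \<Longrightarrow> r < k \<Longrightarrow> s < k \<Longrightarrow>
      v (k * m + r) (k * n + s) = v (k * m' + r) (k * n' + s)"
    and out: "\<And>m n m' n'. v m n = v m' n' \<Longrightarrow> u m n = u m' n'"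
  shows "automatic2 k u"
proof -
  let ?S = "range (\<lambda>(m, n). v m n)"
  obtain e :: "'s \<Rightarrow> nat" where e: "inj_on e ?S"
    using finite_imp_inj_to_nat_seg[OF fin] by blast
  have mem: "v m n \<in> ?S" for m n
    using rangeI[of "\<lambda>(m, n). v m n" "(m, n)"] by simp
  define w where "w m n = e (v m n)" for m n
  define rep where "rep x = (SOME mn. w (fst mn) (snd mn) = x)" for x
  have rep: "v (fst (rep (w m n))) (snd (rep (w m n))) = v m n" for m n
  proof -
    have "w (fst (rep (w m n))) (snd (rep (w m n))) = w m n"
      unfolding rep_def by (rule someI[of _ "(m, n)"]) simp
    then show ?thesis using e mem by (auto simp: w_def dest: inj_onD)
  qed
  define \<phi> where
    "\<phi> x = mat k k (\<lambda>(r, s). w (k * fst (rep x) + r) (k * snd (rep x) + s))" for x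
  let ?A = "e ` ?S"
  have wA: "w m n \<in> ?A" for m n unfolding w_def using mem by blast
  have "uniform_mat_morphism k ?A \<phi>"
    unfolding uniform_mat_morphism_def
    by (auto simp: \<phi>_def elements_mat_def intro!: wA)
  moreover have "apply_morphism k \<phi> w = w"
  proof (intro ext)
    fix m n
    have "w (k * (m div k) + m mod k) (k * (n div k) + n mod k) = apply_morphism k \<phi> w m n"
      using step[OF rep, of "m mod k" "n mod k" "m div k" "n div k"] k
      by (simp add: apply_morphism_def \<phi>_def w_def del: mult_div_mod_eq)
    then show "apply_morphism k \<phi> w m n = w m n" by simp
  qed
  moreover have "u = (\<lambda>m n. u (fst (rep (w m n))) (snd (rep (w m n))))"
    using out[OF rep] by (intro ext) simp
  ultimately show ?thesis
    unfolding automatic2_def using fin wA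
    by (intro exI[of _ ?A] exI[of _ \<phi>] exI[of _ w]
        exI[of _ "\<lambda>x. u (fst (rep x)) (snd (rep x))"]) auto
qed

section \<open>Windows of determinants under the ternary step\<close>

definition window_agree :: "nat \<Rightarrow> nat \<Rightarrow> nat \<Rightarrow> nat \<Rightarrow> nat \<Rightarrow> bool" where
  "window_agree l n p n' p' \<longleftrightarrow> (even n \<longleftrightarrow> even n')
    \<and> (\<forall>i<l. \<forall>j<l. hankel cantor_b (n + i) (p + j) = hankel cantor_b (n' + i) (p' + j)
        \<and> hankel cantor_e (n + i) (p + j) = hankel cantor_e (n' + i) (p' + j))"

text \<open>The recurrences involve only sizes n, n + 1 and shifts p, p + 1; the parity of
  \<open>n\<close> fixes their signs.\<close>

lemma hankel_ternary_cong:
  assumes "window_agree 2 n p n' p'" "r < 3" "s < 3"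
  shows "hankel cantor_b (3 * n + r) (3 * p + s) = hankel cantor_b (3 * n' + r) (3 * p' + s)"
    and "hankel cantor_e (3 * n + r) (3 * p + s) = hankel cantor_e (3 * n' + r) (3 * p' + s)"
proof -
  have sgn: "(- 1 :: F3) ^ n = (- 1) ^ n'"
    using assms(1) unfolding window_agree_def minus_one_power_iff by presburger
  have eq: "hankel cantor_b (n + i) (p + j) = hankel cantor_b (n' + i) (p' + j)"
    "hankel cantor_e (n + i) (p + j) = hankel cantor_e (n' + i) (p' + j)" if "i < 2" "j < 2" for i j
    using assms(1) that by (auto simp: window_agree_def)
  note eqs = eq[of 0 0, simplified] eq[of 0 1, simplified] eq[of 1 0, simplified] eq[of 1 1, simplified]
  have size: "(3 * x + 0) div 3 = x" "(3 * x + 1) div 3 = x" "(3 * x + 2) div 3 = x"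
    "(3 * x + 0 + 1) div 3 = x" "(3 * x + 1 + 1) div 3 = x" "(3 * x + 2 + 1) div 3 = x + 1"
    "(3 * x + 0 + 2) div 3 = x" "(3 * x + 1 + 2) div 3 = x + 1" "(3 * x + 2 + 2) div 3 = x + 1"
    for x :: nat
    by presburger+
  have cases: "r = 0 \<or> r = 1 \<or> r = 2" "s = 0 \<or> s = 1 \<or> s = 2"
    using assms(2,3) by auto
  show "hankel cantor_b (3 * n + r) (3 * p + s) = hankel cantor_b (3 * n' + r) (3 * p' + s)"
    using cases
    by (elim disjE; hypsubst; unfold hankel_cantor_b_0 hankel_cantor_b_1 hankel_cantor_b_2 size)
      (simp_all add: glue_def sgn eqs)
  show "hankel cantor_e (3 * n + r) (3 * p + s) = hankel cantor_e (3 * n' + r) (3 * p' + s)"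
    using cases
    by (elim disjE; hypsubst; unfold hankel_cantor_e_0 hankel_cantor_e_1 hankel_cantor_e_2 size)
      (simp_all add: glue_def sgn eqs)
qed

text \<open>Length 3 is closed under the step: r + i and s + j are at most 4, so the quotients move
  by at most 1 and the required window of length 2 stays inside.\<close>

lemma window_agree_step:
  assumes "window_agree 3 n p n' p'" "r < 3" "s < 3"
  shows "window_agree 3 (3 * n + r) (3 * p + s) (3 * n' + r) (3 * p' + s)"
proof -
  have "hankel cantor_b (3 * n + r + i) (3 * p + s + j) = hankel cantor_b (3 * n' + r + i) (3 * p' + s + j)
    \<and> hankel cantor_e (3 * n + r + i) (3 * p + s + j) = hankel cantor_e (3 * n' + r + i) (3 * p' + s + j)"
    if ij: "i < 3" "j < 3" for i j
  proof -
    define q t where "q = (r + i) div 3" and "t = (s + j) div 3"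
    have qt: "q \<le> 1" "t \<le> 1" using assms(2,3) ij by (simp_all add: q_def t_def)
    have "window_agree 2 (n + q) (p + t) (n' + q) (p' + t)"
      using assms(1) qt by (auto simp: window_agree_def add.assoc)
    from hankel_ternary_cong[OF this, of "(r + i) mod 3" "(s + j) mod 3"]
    have "hankel cantor_b (3 * (n + q) + (r + i) mod 3) (3 * (p + t) + (s + j) mod 3)
        = hankel cantor_b (3 * (n' + q) + (r + i) mod 3) (3 * (p' + t) + (s + j) mod 3)"
      "hankel cantor_e (3 * (n + q) + (r + i) mod 3) (3 * (p + t) + (s + j) mod 3)
        = hankel cantor_e (3 * (n' + q) + (r + i) mod 3) (3 * (p' + t) + (s + j) mod 3)"
      by simp_all
    moreover have "3 * (x + q) + (r + i) mod 3 = 3 * x + r + i" for x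
      by (simp add: q_def distrib_left add.assoc)
    moreover have "3 * (x + t) + (s + j) mod 3 = 3 * x + s + j" for x
      by (simp add: t_def distrib_left add.assoc)
    ultimately show ?thesis by (simp only:)
  qed
  then show ?thesis
    using assms(1) by (auto simp: window_agree_def)
qed

section \<open>Transfer to the integer matrices of both Cantor sequences\<close>

lemma of_int_det_hankel_mat:
  "(of_int (det (hankel_mat a n p)) :: F3) = hankel (\<lambda>i. of_int (a i)) n p"
proof -
  interpret of_int_hom: comm_ring_hom "of_int :: int \<Rightarrow> F3"
    by unfold_locales simp_all
  have "map_mat of_int (hankel_mat a n p) = mat n n (\<lambda>(i, j). (of_int (a (p + i + j)) :: F3))"
    by (rule eq_matI) (simp_all add: hankel_mat_def)
  then show ?thesis
    unfolding hankel_def by (simp flip: of_int_hom.hom_det)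
qed

lemma det_hankel_mat_0: "det (hankel_mat a 0 p) = 1"
  by (simp add: hankel_mat_def)

text \<open>The size modulo 4 fixes both the parity split and the sign (-1)^(N div 2) in
  \<open>hankel_odd_shift\<close>.\<close>

lemma mod_4_eq_imp:
  fixes m n :: nat
  assumes "m mod 4 = n mod 4"
  shows "m mod 2 = n mod 2" "even (m div 2) \<longleftrightarrow> even (n div 2)"
proof -
  show *: "m mod 2 = n mod 2"
    using assms mod_mod_cancel[of 2 4 m] mod_mod_cancel[of 2 4 n] by simp
  have "2 * (m div 2 mod 2) = 2 * (n div 2 mod 2)"
    using assms * mod_mult2_eq[of m 2 2] mod_mult2_eq[of n 2 2] by simp
  then show "even (m div 2) \<longleftrightarrow> even (n div 2)"
    by (simp add: even_iff_mod_2_eq_zero)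
qed

text \<open>Halving commutes with the ternary step up to a new digit, which depends only on
  \<open>n mod 2\<close> and \<open>r\<close> and is below 3 when r < 3.\<close>

lemma triple_add_div_2: "(3 * n + r) div 2 = 3 * (n div 2) + (3 * (n mod 2) + r) div (2 :: nat)"
proof -
  have "3 * n + r = 3 * (n mod 2) + r + 2 * (3 * (n div 2))"
    using mult_div_mod_eq[of 2 n] by linarith
  also have "\<dots> div 2 = 3 * (n div 2) + (3 * (n mod 2) + r) div 2"
    by (simp only: div_mult_self2)
  finally show ?thesis .
qed

lemma hankel_binary_cong:
  fixes a :: "nat \<Rightarrow> F3"
  assumes odd: "\<And>m. a (Suc (2 * m)) = 0"
    and parity: "N mod 4 = N' mod 4" "P mod 2 = P' mod 2"
    and eq: "\<And>i j. i < 2 \<Longrightarrow> j < 2 \<Longrightarrow> hankel (\<lambda>m. a (2 * m)) (N div 2 + i) (P div 2 + j)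
      = hankel (\<lambda>m. a (2 * m)) (N' div 2 + i) (P' div 2 + j)"
  shows "hankel a N P = hankel a N' P'"
proof -
  let ?h = "hankel (\<lambda>m. a (2 * m))"
  define r where "r = N mod 2"
  note mod2 = mod_4_eq_imp(1)[OF parity(1)]
  have r: "r < 2" "(N + 1) div 2 = N div 2 + r" "(N' + 1) div 2 = N' div 2 + r"
    subgoal by (simp add: r_def)
    subgoal unfolding r_def by presburger
    subgoal unfolding r_def mod2 by presburger
    done
  have sgn: "(- 1 :: F3) ^ (N div 2) = (- 1) ^ (N' div 2)"
    by (simp add: minus_one_power_iff mod_4_eq_imp(2)[OF parity(1)])
  show ?thesis
  proof (cases "even P")
    case True
    then have "even P'" using parity(2) by presburger
    with True obtain p p' where p: "P = 2 * p" "P' = 2 * p'" by (auto elim!: evenE)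
    note eqs = eq[unfolded p, simplified]
    show ?thesis
      unfolding p hankel_even_shift[of a, OF odd] r(2,3)
      using eqs[of r 0] eqs[of 0 1] r(1) by simp
  next
    case False
    then have "odd P'" using parity(2) by presburger
    with False obtain p p' where p: "P = 2 * p + 1" "P' = 2 * p' + 1" by (auto elim!: oddE)
    note eqs = eq[unfolded p, simplified]
    show ?thesis
      unfolding p hankel_odd_shift[of a, OF odd] r(2,3)
      by (rule glue_cong) (use eqs[of 0 1] eqs[of r 1] r(1) in \<open>simp_all add: power_add sgn\<close>)
  qed
qed

text \<open>The window is taken at half scale. The Boolean marks the one position where the
  convention for Gamma departs from the empty determinant.\<close>

definition cantor_state :: "nat \<Rightarrow> nat \<Rightarrow> nat \<times> nat \<times> bool \<times> (F3 \<times> F3) list list" where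
  "cantor_state N P = (N mod 4, P mod 2, N = 0 \<and> P = 0,
    map (\<lambda>i. map (\<lambda>j. (hankel cantor_b (N div 2 + i) (P div 2 + j), hankel cantor_e (N div 2 + i) (P div 2 + j)))
      [0..<3]) [0..<3])"

lemma cantor_state_eq_iff:
  "cantor_state N P = cantor_state N' P' \<longleftrightarrow> N mod 4 = N' mod 4 \<and> P mod 2 = P' mod 2
    \<and> (N = 0 \<and> P = 0 \<longleftrightarrow> N' = 0 \<and> P' = 0)
    \<and> window_agree 3 (N div 2) (P div 2) (N' div 2) (P' div 2)"
  using mod_4_eq_imp(2)[of N N'] by (auto simp: cantor_state_def window_agree_def simp del: upt_Suc)

lemma finite_range_cantor_state: "finite (range (\<lambda>(N, P). cantor_state N P))"
proof -
  have F: "finite (UNIV :: (F3 \<times> F3) set)"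
    using finite_cartesian_product[OF finite_UNIV_F3 finite_UNIV_F3] by simp
  let ?L = "{xs :: (F3 \<times> F3) list. set xs \<subseteq> UNIV \<and> length xs = 3}"
  have "finite ?L" by (rule finite_lists_length_eq[OF F])
  then have "finite {xss. set xss \<subseteq> ?L \<and> length xss = 3}" by (rule finite_lists_length_eq)
  then have "finite ({..<4 :: nat} \<times> {..<2 :: nat} \<times> (UNIV :: bool set) \<times> {xss. set xss \<subseteq> ?L \<and> length xss = 3})"
    by simp
  then show ?thesis
    by (rule finite_subset[rotated]) (auto simp: cantor_state_def simp del: upt_Suc)
qed

lemma cantor_state_step:
  assumes "cantor_state N P = cantor_state N' P'" "r < 3" "s < 3"
  shows "cantor_state (3 * N + r) (3 * P + s) = cantor_state (3 * N' + r) (3 * P' + s)"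
proof -
  have eq: "N mod 4 = N' mod 4" "P mod 2 = P' mod 2" "N = 0 \<and> P = 0 \<longleftrightarrow> N' = 0 \<and> P' = 0"
    "window_agree 3 (N div 2) (P div 2) (N' div 2) (P' div 2)"
    using assms(1) by (auto simp: cantor_state_eq_iff)
  define r' s' where "r' = (3 * (N mod 2) + r) div 2" and "s' = (3 * (P mod 2) + s) div 2"
  have "3 * (k mod 2) \<le> 3" for k :: nat by simp
  from this[of N] this[of P] have "r' < 3" "s' < 3"
    using assms(2,3) by (simp_all add: r'_def s'_def less_mult_imp_div_less)
  note window_agree_step[OF eq(4) this]
  moreover have "(3 * N + r) div 2 = 3 * (N div 2) + r'" "(3 * P + s) div 2 = 3 * (P div 2) + s'"
    unfolding r'_def s'_def by (rule triple_add_div_2)+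
  moreover have "(3 * N' + r) div 2 = 3 * (N' div 2) + r'" "(3 * P' + s) div 2 = 3 * (P' div 2) + s'"
    unfolding r'_def s'_def mod_4_eq_imp(1)[OF eq(1)] eq(2) by (rule triple_add_div_2)+
  moreover have "(3 * N + r) mod 4 = (3 * N' + r) mod 4" "(3 * P + s) mod 2 = (3 * P' + s) mod 2"
    by (intro mod_add_cong mod_mult_cong refl eq(1,2))+
  ultimately show ?thesis using eq(3) by (auto simp: cantor_state_eq_iff)
qed

lemma det_hankel_mat_mod_3_cong:
  assumes "cantor_state N P = cantor_state N' P'"
  shows "det (hankel_mat cantor N P) mod 3 = det (hankel_mat cantor N' P') mod 3"
    and "det (hankel_mat cantor_d N P) mod 3 = det (hankel_mat cantor_d N' P') mod 3"
proof -
  have eq: "N mod 4 = N' mod 4" "P mod 2 = P' mod 2"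
    "window_agree 3 (N div 2) (P div 2) (N' div 2) (P' div 2)"
    using assms by (auto simp: cantor_state_eq_iff)
  show "det (hankel_mat cantor N P) mod 3 = det (hankel_mat cantor N' P') mod 3"
    by (rule of_int_F3_eq_imp_mod_eq, unfold of_int_det_hankel_mat, rule hankel_binary_cong)
      (use eq cantor_odd in \<open>auto simp: window_agree_def simp flip: cantor_b_def\<close>)
  show "det (hankel_mat cantor_d N P) mod 3 = det (hankel_mat cantor_d N' P') mod 3"
    by (rule of_int_F3_eq_imp_mod_eq, unfold of_int_det_hankel_mat, rule hankel_binary_cong)
      (use eq cantor_d_odd in \<open>auto simp: window_agree_def simp flip: cantor_e_def\<close>)
qed

theorem theorem3:
  "automatic2 3 (\<lambda>n p. Gamma_det n p mod 3) \<and> automatic2 3 (\<lambda>n p. Delta_det n p mod 3)"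
proof
  show "automatic2 3 (\<lambda>n p. Gamma_det n p mod 3)"
  proof (rule automatic2I[OF _ finite_range_cantor_state cantor_state_step])
    fix n p n' p'
    assume eq: "cantor_state n p = cantor_state n' p'"
    \<comment> \<open>An empty determinant is 1, so only the value 2 at the origin needs a separate
      case.\<close>
    have Gamma: "Gamma_det n p = (if n = 0 \<and> p = 0 then 2 else det (hankel_mat cantor n p))" for n p
      by (simp add: Gamma_det_def det_hankel_mat_0)
    show "Gamma_det n p mod 3 = Gamma_det n' p' mod 3"
      using det_hankel_mat_mod_3_cong(1)[OF eq] eq by (auto simp: Gamma cantor_state_eq_iff)
  qed simp_all
  show "automatic2 3 (\<lambda>n p. Delta_det n p mod 3)"
  proof (rule automatic2I[OF _ finite_range_cantor_state cantor_state_step])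
    fix n p n' p'
    assume eq: "cantor_state n p = cantor_state n' p'"
    have Delta: "Delta_det n p = det (hankel_mat cantor_d n p)" for n p
      by (simp add: Delta_det_def det_hankel_mat_0)
    show "Delta_det n p mod 3 = Delta_det n' p' mod 3"
      unfolding Delta by (rule det_hankel_mat_mod_3_cong(2)[OF eq])
  qed simp_all
qed

end
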